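(* Let $(X,U)\in\mathbb{R}^d\times\mathbb{R}^k$ have, given $(\theta,\eta)$, density $$\eta^{(d+k)/2}\,f\!\left(\eta\left(\|x-\theta\|^2+\|u\|^2\right)\right),\qquad \theta\in\mathbb{R}^d,\ \eta>0,$$ and let $(\theta,\eta)$ have the (improper) prior density $\pi_1(\theta)\,\eta^a$, $a\in\mathbb{R}$, with respect to $d\nu(\theta)\,d\eta$, where $\nu$ is a $\sigma$-finite measure on $\mathbb{R}^d$. For a given $(x,u)$, let $\tau=\eta\left(\|\theta-x\|^2+\|u\|^2\right)$, and assume that $$\int_{\mathbb{R}_+}t^{a+\frac{d+k}{2}}f(t)\,dt<\infty\quad\text{and}\quad\int_{\mathbb{R}^d}\frac{\pi_1(z)}{\left(\|z-x\|^2+\|u\|^2\right)^{a+1+\frac{d+k}{2}}}\,d\nu(z)<\infty .$$ Then, conditional on $(x,u)$, $\theta$ and $\tau$ are independent, with densities (with respect to $\nu$ for $\theta$ and Lebesgue measure on $(0,\infty)$ for $\tau$) $$\tau|x,u\ \propto\ \tau^{a+\frac{d+k}{2}}f(\tau)\quad\text{and}\quad \theta|x,u\ \propto\ \frac{\pi_1(\theta)}{\left(\|\theta-x\|^2+\|u\|^2\right)^{a+1+\frac{d+k}{2}}} .$$ Moreover, the marginal posterior distribution of $\theta$ does not depend on $f$, while the marginal posterior distribution of $\tau$ does not depend on $\pi_1$.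
   Context: $f:[0,\infty)\to[0,\infty)$ is a known function such that $t\mapsto f(\|t\|^2)$ is a probability density on $\mathbb{R}^{d+k}$. $\pi_1\ge 0$ is a (not necessarily normalizable, not $\nu$-a.e. zero) density with respect to $\nu$. The posterior distribution of $(\theta,\eta)$ given $(x,u)$ is the probability measure with density, with respect to $d\nu(\theta)\,d\eta$, proportional to the likelihood times the prior density.
   Formalization: If u = 0, the integrand of the second condition at z = x is read as infinite when π₁(x) > 0, even for exponent a+1+(d+k)/2 ≤ 0; this excludes u = 0 with ν having an atom at x where π₁(x) > 0, a case where the claim can fail or is undefined. *)

theory Defs
  imports "HOL-Probability.Probability"
begin

text \<open>
  The parameter is a pair \<open>(\<theta>, \<eta>)\<close> in \<open>(real ^ 'd) \<times> real\<close>. The half-line \<open>\<eta> > 0\<close> (and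
  likewise \<open>\<tau> > 0\<close>) is encoded by an indicator, so that all densities are taken with
  respect to \<^const>\<open>lborel\<close> on the whole line. The generator \<open>f\<close> is a total function, of which
  only the values on \<open>[0, \<infinity>)\<close> are ever constrained or used.
\<close>

definition radial_density :: "'n::finite itself \<Rightarrow> (real \<Rightarrow> real) \<Rightarrow> bool" where
  "radial_density _ f \<longleftrightarrow>
     (\<forall>s\<ge>0. 0 \<le> f s) \<and>
     (\<lambda>t::real^'n. f ((norm t)\<^sup>2)) \<in> borel_measurable borel \<and>
     (\<integral>\<^sup>+ t. ennreal (f ((norm (t::real^'n))\<^sup>2)) \<partial>lborel) = 1"

definition prior_factor :: "(real^'d) measure \<Rightarrow> (real^'d \<Rightarrow> real) \<Rightarrow> bool" where
  "prior_factor \<nu> \<pi> \<longleftrightarrow>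
     \<pi> \<in> borel_measurable \<nu> \<and> (\<forall>z. 0 \<le> \<pi> z) \<and> \<not> (AE z in \<nu>. \<pi> z = 0)"

definition likelihood ::
  "(real \<Rightarrow> real) \<Rightarrow> (real^'d) \<times> (real^'k) \<Rightarrow> (real^'d) \<times> real \<Rightarrow> real" where
  "likelihood f = (\<lambda>(x, u) (\<theta>, \<eta>).
     \<eta> powr ((real CARD('d) + real CARD('k)) / 2) *
       f (\<eta> * ((norm (x - \<theta>))\<^sup>2 + (norm u)\<^sup>2)))"

definition prior :: "(real^'d \<Rightarrow> real) \<Rightarrow> real \<Rightarrow> (real^'d) \<times> real \<Rightarrow> real" where
  "prior \<pi> a = (\<lambda>(\<theta>, \<eta>). indicator {0<..} \<eta> * \<pi> \<theta> * \<eta> powr a)"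

text \<open>
  Bayes' formula for a possibly improper prior density \<open>p\<close> with respect to \<open>M\<close>. The result is a
  probability measure only if the normalizing integral is positive and finite.
\<close>

definition posterior :: "'p measure \<Rightarrow> ('p \<Rightarrow> real) \<Rightarrow> ('p \<Rightarrow> real) \<Rightarrow> 'p measure" where
  "posterior M l p =
     density M (\<lambda>w. ennreal (l w * p w) / (\<integral>\<^sup>+ v. ennreal (l v * p v) \<partial>M))"

definition tau :: "(real^'d) \<times> (real^'k) \<Rightarrow> (real^'d) \<times> real \<Rightarrow> real" where
  "tau = (\<lambda>(x, u) (\<theta>, \<eta>). \<eta> * ((norm (\<theta> - x))\<^sup>2 + (norm u)\<^sup>2))"

definition tau_kernel :: "real \<Rightarrow> (real \<Rightarrow> real) \<Rightarrow> real \<Rightarrow> ennreal" where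
  "tau_kernel q f t = ennreal (indicator {0<..} t * (t powr q * f t))"

text \<open>
  The quotient is taken in \<^typ>\<open>ennreal\<close>, where \<open>c / 0 = \<infinity>\<close> for \<open>c > 0\<close> and \<open>0 / 0 = 0\<close>. Since
  \<open>0 powr q = 0\<close> for every \<open>q\<close>, the kernel is infinite at \<open>z = x\<close> if \<open>u = 0\<close> and \<open>\<pi> x > 0\<close>,
  whatever the sign of \<open>q\<close>. Finiteness of its integral thus includes that the base of the
  power is nonzero almost everywhere for the measure with density \<open>\<pi>\<close>.
\<close>

definition theta_kernel ::
  "real \<Rightarrow> (real^'d \<Rightarrow> real) \<Rightarrow> (real^'d) \<times> (real^'k) \<Rightarrow> real^'d \<Rightarrow> ennreal" where
  "theta_kernel q \<pi> = (\<lambda>(x, u) z.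
     ennreal (\<pi> z) / ennreal (((norm (z - x))\<^sup>2 + (norm u)\<^sup>2) powr q))"

definition distributed_proportional ::
  "'p measure \<Rightarrow> 'b measure \<Rightarrow> ('p \<Rightarrow> 'b) \<Rightarrow> ('b \<Rightarrow> ennreal) \<Rightarrow> bool" where
  "distributed_proportional P N Y h \<longleftrightarrow>
     (\<exists>c::real. c > 0 \<and> distributed P N Y (\<lambda>y. ennreal c * h y))"

text \<open>
  The library's \<open>indep_var\<close> forces both random variables to have the same codomain type. This is
  the right-hand side of \<open>indep_var_eq\<close>, which makes sense for two different codomain types.
\<close>

definition indep_var_het ::
  "'p measure \<Rightarrow> 'b measure \<Rightarrow> ('p \<Rightarrow> 'b) \<Rightarrow> 'c measure \<Rightarrow> ('p \<Rightarrow> 'c) \<Rightarrow> bool" where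
  "indep_var_het P S X T Y \<longleftrightarrow>
     X \<in> measurable P S \<and> Y \<in> measurable P T \<and>
     prob_space.indep_set P
       (sigma_sets (space P) {X -` A \<inter> space P | A. A \<in> sets S})
       (sigma_sets (space P) {Y -` B \<inter> space P | B. B \<in> sets T})"

end

theory Submission
  imports Defs
begin

text \<open>
  For fixed \<open>\<theta>\<close>, substituting \<open>\<tau> = \<eta> (\<parallel>\<theta> - x\<parallel>\<^sup>2 + \<parallel>u\<parallel>\<^sup>2)\<close> turns likelihood times prior into the
  product of the two kernels. So the posterior probability of \<open>\<theta> \<in> A, \<tau> \<in> B\<close> is a product of a
  ratio of integrals of the \<open>\<theta>\<close>-kernel, free of \<open>f\<close>, and one of the \<open>\<tau>\<close>-kernel, free of \<open>\<pi>\<^sub>1\<close>.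
  Both normalizing integrals must be nonzero; for the \<open>\<tau>\<close>-kernel this uses that \<open>f\<close> generates a
  probability density.
\<close>

section \<open>Measurability of the radial generator and of the \<tau>-kernel\<close>

lemma radial_density_nonneg:
  assumes "radial_density TYPE('n::finite) f" "0 \<le> s"
  shows "0 \<le> f s"
  using assms by (auto simp: radial_density_def)

text \<open>On the negative half-line \<open>f\<close> is arbitrary, so \<open>f\<close> itself need not be measurable.\<close>

lemma radial_density_measurable:
  assumes "radial_density TYPE('n::finite) f"
  shows "(\<lambda>s. f (max 0 s)) \<in> borel_measurable borel"
proof -
  \<comment> \<open>A ray through a unit vector recovers the radial profile: the point
    \<open>sqrt (max 0 s) *\<^sub>R e\<close> has squared norm \<open>max 0 s\<close>.\<close>
  define e :: "real^'n" where "e = axis undefined 1"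
  have e: "norm e = 1" by (simp add: e_def)
  have [measurable]: "(\<lambda>t::real^'n. f ((norm t)\<^sup>2)) \<in> borel_measurable borel"
    using assms by (auto simp: radial_density_def)
  have "(\<lambda>s. f ((norm (sqrt (max 0 s) *\<^sub>R e))\<^sup>2)) \<in> borel_measurable borel"
    by (rule measurable_compose[where g = "\<lambda>t. f ((norm t)\<^sup>2)"]) measurable
  also have "(\<lambda>s. f ((norm (sqrt (max 0 s) *\<^sub>R e))\<^sup>2)) = (\<lambda>s. f (max 0 s))"
    by (simp add: e)
  finally show ?thesis .
qed

text \<open>The indicator vanishes for \<open>t \<le> 0\<close>, so clipping the argument of
  \<open>f\<close> changes nothing, and it is the clipped \<open>f\<close> that is known to be
  measurable.\<close>

lemma tau_kernel_max: "tau_kernel q f t = ennreal (indicator {0<..} t * (t powr q * f (max 0 t)))"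
  by (simp add: tau_kernel_def max_def indicator_def)

lemma tau_kernel_measurable:
  assumes "radial_density TYPE('n::finite) f"
  shows "tau_kernel q f \<in> borel_measurable borel"
proof -
  note radial_density_measurable[OF assms, measurable]
  show ?thesis unfolding tau_kernel_max[abs_def] by measurable
qed

section \<open>Positivity of the normalizing integral of the \<tau>-kernel\<close>

text \<open>Substituting \<open>sqrt s *\<^sub>R t\<close> for \<open>t\<close> in the normalized
  integral of \<open>f\<close> shows that the integral here, multiplied by a power of
  \<open>sqrt s\<close>, equals 1.\<close>

lemma nn_integral_radial_scale_neq_0:
  assumes f: "radial_density TYPE('n::finite) f" and s: "0 < s"
  shows "(\<integral>\<^sup>+ t. ennreal (f (s * (norm (t::real^'n))\<^sup>2)) \<partial>lborel) \<noteq> 0"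
proof
  have [measurable]: "(\<lambda>t::real^'n. f ((norm t)\<^sup>2)) \<in> borel_measurable borel"
    using f by (auto simp: radial_density_def)
  let ?c = "sqrt s"
  have "1 = (\<integral>\<^sup>+ t. ennreal (f ((norm (t::real^'n))\<^sup>2)) \<partial>lborel)"
    using f by (auto simp: radial_density_def)
  also have "\<dots> = (\<integral>\<^sup>+ t. ennreal (f ((norm t)\<^sup>2))
      \<partial>density (distr lborel borel (\<lambda>x::real^'n. 0 + ?c *\<^sub>R x)) (\<lambda>_. \<bar>?c\<bar> ^ DIM(real^'n)))"
    by (subst lborel_affine[of ?c 0]) (use s in auto)
  also have "\<dots> = (\<integral>\<^sup>+ t. \<bar>?c\<bar> ^ DIM(real^'n) * ennreal (f ((norm (?c *\<^sub>R (t::real^'n)))\<^sup>2)) \<partial>lborel)"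
    by (simp add: nn_integral_density nn_integral_distr)
  also have "\<dots> = \<bar>?c\<bar> ^ DIM(real^'n) * (\<integral>\<^sup>+ t. ennreal (f ((norm (?c *\<^sub>R (t::real^'n)))\<^sup>2)) \<partial>lborel)"
    by (rule nn_integral_cmult, rule measurable_compose[where g = ennreal],
        rule measurable_compose[where g = "\<lambda>t. f ((norm t)\<^sup>2)"]) measurable
  also have "\<dots> = \<bar>?c\<bar> ^ DIM(real^'n) * (\<integral>\<^sup>+ t. ennreal (f (s * (norm (t::real^'n))\<^sup>2)) \<partial>lborel)"
    using s by (simp add: power_mult_distrib)
  finally have *: "1 = \<bar>?c\<bar> ^ DIM(real^'n) * (\<integral>\<^sup>+ t. ennreal (f (s * (norm (t::real^'n))\<^sup>2)) \<partial>lborel)" .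
  assume "(\<integral>\<^sup>+ t. ennreal (f (s * (norm (t::real^'n))\<^sup>2)) \<partial>lborel) = 0"
  with * show False by simp
qed

text \<open>
  If \<open>f\<close> vanished almost everywhere, then so would \<open>s \<mapsto> f (s \<parallel>t\<parallel>\<^sup>2)\<close> for each \<open>t \<noteq> 0\<close>. By Tonelli,
  integrating over \<open>t\<close> would give \<open>0\<close> for almost every \<open>s > 0\<close>, whereas scaling gives a
  positive value for every \<open>s > 0\<close>. This replaces polar coordinates.
\<close>

lemma nn_integral_tau_kernel_neq_0:
  assumes f: "radial_density TYPE('n::finite) f"
  shows "(\<integral>\<^sup>+ t. tau_kernel q f t \<partial>lborel) \<noteq> 0"
proof
  note radial_density_measurable[OF f, measurable] tau_kernel_measurable[OF f, measurable]
  \<comment> \<open>The factor \<open>t powr q\<close> is positive for \<open>t > 0\<close>, so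
    dropping it keeps the zeros: \<open>h\<close> vanishes wherever the kernel does, whatever
    \<open>q\<close> is.\<close>
  define h where "h s = indicator {0<..} s * ennreal (f (max 0 s))" for s :: real
  have h[measurable]: "h \<in> borel_measurable borel" unfolding h_def by measurable
  assume "(\<integral>\<^sup>+ t. tau_kernel q f t \<partial>lborel) = 0"
  then have "AE t in lborel. tau_kernel q f t = 0"
    by (subst (asm) nn_integral_0_iff_AE) auto
  then have "AE t in lborel. h t = 0"
  proof eventually_elim
    case (elim t)
    then show ?case
      using radial_density_nonneg[OF f, of t]
      by (cases "t > 0") (auto simp: h_def tau_kernel_def mult_le_0_iff ennreal_eq_0_iff)
  qed
  then have h0: "(\<integral>\<^sup>+ t. h t \<partial>lborel) = 0"
    by (subst nn_integral_0_iff_AE) auto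
  \<comment> \<open>The substitution \<open>t = c * s\<close> shows that the integral of
    \<open>h\<close> is \<open>c\<close> times this one.\<close>
  have scale: "(\<integral>\<^sup>+ s. h (s * c) \<partial>lborel) = 0" if "0 < c" for c
    using nn_integral_real_affine[of h c 0] h0 that by (auto simp: mult.commute)
  have "(\<integral>\<^sup>+ s. (\<integral>\<^sup>+ t. h (s * (norm (t::real^'n))\<^sup>2) \<partial>lborel) \<partial>lborel)
      = (\<integral>\<^sup>+ t. (\<integral>\<^sup>+ s. h (s * (norm (t::real^'n))\<^sup>2) \<partial>lborel) \<partial>lborel)"
    by (rule lborel_pair.Fubini') measurable
  also have "\<dots> = (\<integral>\<^sup>+ t. 0 \<partial>(lborel :: (real^'n) measure))"
  proof (rule nn_integral_cong_AE)
    show "AE t in lborel. (\<integral>\<^sup>+ s. h (s * (norm (t::real^'n))\<^sup>2) \<partial>lborel) = 0"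
      using AE_lborel_singleton[of 0] by eventually_elim (rule scale, simp)
  qed
  finally have "(\<integral>\<^sup>+ s. (\<integral>\<^sup>+ t. h (s * (norm (t::real^'n))\<^sup>2) \<partial>lborel) \<partial>lborel) = 0" by simp
  then have "AE s in lborel. (\<integral>\<^sup>+ t. h (s * (norm (t::real^'n))\<^sup>2) \<partial>lborel) = 0"
    by (subst (asm) nn_integral_0_iff_AE) auto
  moreover have "(\<integral>\<^sup>+ t. h (s * (norm (t::real^'n))\<^sup>2) \<partial>lborel) \<noteq> 0" if s: "0 < s" for s
  proof -
    have "(\<integral>\<^sup>+ t. h (s * (norm (t::real^'n))\<^sup>2) \<partial>lborel)
        = (\<integral>\<^sup>+ t. ennreal (f (s * (norm (t::real^'n))\<^sup>2)) \<partial>lborel)"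
    proof (rule nn_integral_cong_AE)
      \<comment> \<open>At \<open>t = 0\<close> the two sides may differ: the indicator makes
        \<open>h 0\<close> zero, while \<open>f 0\<close> can be positive.\<close>
      show "AE t in lborel. h (s * (norm (t::real^'n))\<^sup>2) = ennreal (f (s * (norm t)\<^sup>2))"
        using AE_lborel_singleton[of 0] by eventually_elim (use s in \<open>simp add: h_def\<close>)
    qed
    with nn_integral_radial_scale_neq_0[OF f s] show ?thesis by simp
  qed
  ultimately have "AE s in lborel. s \<le> (0::real)"
    by (auto elim!: eventually_mono simp: not_less[symmetric])
  then have "emeasure lborel {s::real. \<not> s \<le> 0} = 0"
    by (subst (asm) AE_iff_measurable[OF _ refl]) auto
  moreover have "emeasure lborel {0<..<1::real} \<le> emeasure lborel {s::real. \<not> s \<le> 0}"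
    by (rule emeasure_mono) auto
  ultimately show False by simp
qed

section \<open>Measurability and positivity for the \<theta>-kernel\<close>

lemma theta_kernel_measurable:
  assumes "sets \<nu> = sets borel" "prior_factor \<nu> \<pi>"
  shows "theta_kernel q \<pi> (x, u) \<in> borel_measurable \<nu>"
proof -
  note assms(1)[measurable_cong]
  have [measurable]: "\<pi> \<in> borel_measurable \<nu>" using assms(2) by (simp add: prior_factor_def)
  show ?thesis unfolding theta_kernel_def split by measurable
qed

text \<open>The denominator is the image of a real number, hence never infinite, so the quotient
  vanishes exactly when the numerator does, even where the denominator is 0.\<close>

lemma theta_kernel_eq_0_iff: "theta_kernel q \<pi> (x, u) z = 0 \<longleftrightarrow> \<pi> z \<le> 0"
  by (simp add: theta_kernel_def ennreal_divide_eq_0_iff ennreal_eq_0_iff)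

text \<open>A vanishing integral would force \<open>\<pi>\<close> to be zero almost everywhere,
  which \<open>prior_factor\<close> excludes.\<close>

lemma nn_integral_theta_kernel_neq_0:
  assumes "sets \<nu> = sets borel" "prior_factor \<nu> \<pi>"
  shows "(\<integral>\<^sup>+ z. theta_kernel q \<pi> (x, u) z \<partial>\<nu>) \<noteq> 0"
proof
  assume "(\<integral>\<^sup>+ z. theta_kernel q \<pi> (x, u) z \<partial>\<nu>) = 0"
  then have "AE z in \<nu>. \<pi> z \<le> 0"
    by (subst (asm) nn_integral_0_iff_AE[OF theta_kernel_measurable[OF assms]])
       (simp add: theta_kernel_eq_0_iff)
  then have "AE z in \<nu>. \<pi> z = 0"
    by eventually_elim (use assms(2) in \<open>simp add: prior_factor_def order_antisym\<close>)
  with assms(2) show False by (simp add: prior_factor_def)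
qed

section \<open>The posterior on rectangles in \<theta> and \<tau>\<close>

text \<open>For positive \<open>\<eta>\<close> the value of \<open>tau\<close> is nonnegative, and
  otherwise the indicator in the prior is 0. So \<open>f\<close> may be clipped, which is what gives
  measurability of likelihood times prior.\<close>

lemma likelihood_prior_max:
  fixes x :: "real^'d" and u :: "real^'k"
  shows "likelihood f (x, u) w * prior \<pi> a w =
    snd w powr ((real CARD('d) + real CARD('k)) / 2) * f (max 0 (tau (x, u) w))
      * (indicator {0<..} (snd w) * \<pi> (fst w) * snd w powr a)"
  by (cases w) (auto simp: likelihood_def prior_def tau_def norm_minus_commute indicator_def max_def
      zero_le_mult_iff)

lemma tau_measurable: "tau (x, u) \<in> borel_measurable (borel \<Otimes>\<^sub>M borel)"
  unfolding tau_def split_beta' fst_conv snd_conv by measurable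

lemma likelihood_prior_measurable:
  fixes x :: "real^'d" and u :: "real^'k"
  assumes "sets \<nu> = sets borel" "radial_density TYPE('n::finite) f" "prior_factor \<nu> \<pi>"
  shows "(\<lambda>w. likelihood f (x, u) w * prior \<pi> a w) \<in> borel_measurable (\<nu> \<Otimes>\<^sub>M lborel)"
proof -
  note assms(1)[measurable_cong] radial_density_measurable[OF assms(2), measurable]
    tau_measurable[measurable]
  have [measurable]: "\<pi> \<in> borel_measurable \<nu>" using assms(3) by (simp add: prior_factor_def)
  have [measurable]: "tau (x, u) \<in> borel_measurable (\<nu> \<Otimes>\<^sub>M lborel)" by measurable
  have [measurable]: "(\<lambda>w. f (max 0 (tau (x, u) w))) \<in> borel_measurable (\<nu> \<Otimes>\<^sub>M lborel)"
    by (rule measurable_compose[where g = "\<lambda>s. f (max 0 s)"]) measurable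
  show ?thesis unfolding likelihood_prior_max by measurable
qed

text \<open>Finiteness of the kernel at \<open>z\<close> excludes the degenerate case \<open>z = x, u = 0, \<pi> z > 0\<close>.\<close>

lemma nn_integral_eta:
  fixes x :: "real^'d" and u :: "real^'k"
  defines "n \<equiv> real CARD('d) + real CARD('k)"
  assumes f: "radial_density TYPE('n::finite) f" and \<pi>: "0 \<le> \<pi> z"
    and fin: "theta_kernel (a + 1 + n / 2) \<pi> (x, u) z \<noteq> \<infinity>" and B[measurable]: "B \<in> sets borel"
  shows "(\<integral>\<^sup>+ \<eta>. ennreal (likelihood f (x, u) (z, \<eta>) * prior \<pi> a (z, \<eta>))
        * indicator B (tau (x, u) (z, \<eta>)) \<partial>lborel)
    = theta_kernel (a + 1 + n / 2) \<pi> (x, u) z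
        * (\<integral>\<^sup>+ t. tau_kernel (a + n / 2) f t * indicator B t \<partial>lborel)"
\<comment> \<open>If \<open>\<pi> z = 0\<close>, both sides are 0, even at a zero denominator, since
  \<open>0 / 0 = 0\<close> in \<open>ennreal\<close>. In the other case the squared distance
  \<open>b\<close> is positive and can serve as a scale.\<close>
proof (cases "\<pi> z = 0")
  case True
  then show ?thesis by (simp add: prior_def theta_kernel_def)
next
  case False
  define b where "b = (norm (z - x))\<^sup>2 + (norm u)\<^sup>2"
  define q where "q = a + n / 2"
  note tau_kernel_measurable[OF f, measurable]
  have "b \<noteq> 0"
    using fin False \<pi> by (auto simp: theta_kernel_def b_def ennreal_divide_eq_top_iff ennreal_eq_0_iff)
  moreover have "0 \<le> b" by (simp add: b_def)
  ultimately have b: "0 < b" by simp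
  have th: "theta_kernel (a + 1 + n / 2) \<pi> (x, u) z = ennreal (\<pi> z / b powr (q + 1))"
  proof -
    have q1: "q + 1 = a + 1 + n / 2" by (simp add: q_def)
    show ?thesis
      unfolding q1 using b \<pi> by (simp add: theta_kernel_def b_def[symmetric] divide_ennreal)
  qed
  \<comment> \<open>The substitution \<open>t = b * \<eta>\<close> is applied to the right-hand side
    of the claim and contributes the Jacobian \<open>b\<close>.\<close>
  have "theta_kernel (a + 1 + n / 2) \<pi> (x, u) z
      * (\<integral>\<^sup>+ t. tau_kernel q f t * indicator B t \<partial>lborel)
    = ennreal (\<pi> z / b powr (q + 1)) * (ennreal b *
        (\<integral>\<^sup>+ \<eta>. tau_kernel q f (b * \<eta>) * indicator B (b * \<eta>) \<partial>lborel))"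
    unfolding th using nn_integral_real_affine[of "\<lambda>t. tau_kernel q f t * indicator B t" b 0] b
    by simp
  also have "\<dots> = (\<integral>\<^sup>+ \<eta>. ennreal (\<pi> z / b powr (q + 1)) * ennreal b *
        (tau_kernel q f (b * \<eta>) * indicator B (b * \<eta>)) \<partial>lborel)"
    by (subst nn_integral_cmult) (auto simp: mult.assoc)
  also have "\<dots> = (\<integral>\<^sup>+ \<eta>. ennreal (likelihood f (x, u) (z, \<eta>) * prior \<pi> a (z, \<eta>))
        * indicator B (tau (x, u) (z, \<eta>)) \<partial>lborel)"
  proof (rule nn_integral_cong)
    fix \<eta> :: real
    show "ennreal (\<pi> z / b powr (q + 1)) * ennreal b *
        (tau_kernel q f (b * \<eta>) * indicator B (b * \<eta>)) =
      ennreal (likelihood f (x, u) (z, \<eta>) * prior \<pi> a (z, \<eta>)) * indicator B (tau (x, u) (z, \<eta>))"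
    proof (cases "0 < \<eta>")
      case True
      have tau: "tau (x, u) (z, \<eta>) = b * \<eta>" by (simp add: tau_def b_def mult.commute)
      have nn: "0 \<le> f (b * \<eta>)" using radial_density_nonneg[OF f] b True by simp
      have "ennreal (\<pi> z / b powr (q + 1)) * ennreal b * tau_kernel q f (b * \<eta>)
          = ennreal (\<pi> z / b powr (q + 1) * b * (b powr q * \<eta> powr q * f (b * \<eta>)))"
        using True b \<pi> nn
        by (simp add: tau_kernel_def powr_mult ennreal_mult[symmetric] del: times_divide_eq_left)
      \<comment> \<open>All powers of \<open>b\<close> cancel: one from the Jacobian and
        \<open>q\<close> from the \<tau>-kernel meet \<open>q + 1\<close> in the denominator. The
        remaining \<open>\<eta> powr q\<close> splits into the factor of exponent \<open>a\<close>
        from the prior and that of exponent \<open>n / 2\<close> from the likelihood.\<close>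
      also have "\<pi> z / b powr (q + 1) * b * (b powr q * \<eta> powr q * f (b * \<eta>))
          = likelihood f (x, u) (z, \<eta>) * prior \<pi> a (z, \<eta>)"
        using True b
        by (simp add: likelihood_def prior_def b_def[symmetric] norm_minus_commute[of x z] q_def
            n_def[symmetric] powr_add mult.commute[of \<eta> b])
      finally show ?thesis by (simp add: tau mult.assoc[symmetric])
    next
      case False
      with b have "\<not> 0 < b * \<eta>" by (simp add: zero_less_mult_iff)
      with False show ?thesis by (simp add: tau_kernel_def prior_def)
    qed
  qed
  finally show ?thesis by (simp add: q_def)
qed

text \<open>By Tonelli, \<open>\<eta>\<close> is integrated first with \<open>z\<close> fixed. The
  finite integral makes the \<theta>-kernel finite for almost every \<open>z\<close>, so the
  substitution applies there; the resulting \<tau>-integral is free of \<open>z\<close> and factors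
  out.\<close>

lemma nn_integral_rectangle:
  fixes x :: "real^'d" and u :: "real^'k"
  defines "n \<equiv> real CARD('d) + real CARD('k)"
  assumes \<nu>: "sigma_finite_measure \<nu>" "sets \<nu> = sets borel"
    and f: "radial_density TYPE('n::finite) f" and \<pi>: "prior_factor \<nu> \<pi>"
    and fin: "(\<integral>\<^sup>+ z. theta_kernel (a + 1 + n / 2) \<pi> (x, u) z \<partial>\<nu>) < \<infinity>"
    and A: "A \<in> sets borel" and B: "B \<in> sets borel"
  shows "(\<integral>\<^sup>+ w. ennreal (likelihood f (x, u) w * prior \<pi> a w)
        * indicator {w. fst w \<in> A \<and> tau (x, u) w \<in> B} w \<partial>(\<nu> \<Otimes>\<^sub>M lborel))
    = (\<integral>\<^sup>+ z. theta_kernel (a + 1 + n / 2) \<pi> (x, u) z * indicator A z \<partial>\<nu>)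
        * (\<integral>\<^sup>+ t. tau_kernel (a + n / 2) f t * indicator B t \<partial>lborel)"
proof -
  interpret sigma_finite_measure \<nu> by fact
  note \<nu>(2)[measurable_cong] A[measurable] B[measurable]
    likelihood_prior_measurable[OF \<nu>(2) f \<pi>, measurable]
    theta_kernel_measurable[OF \<nu>(2) \<pi>, measurable] tau_measurable[measurable]
  have [measurable]: "tau (x, u) \<in> borel_measurable (\<nu> \<Otimes>\<^sub>M lborel)" by measurable
  have AE: "AE z in \<nu>. theta_kernel (a + 1 + n / 2) \<pi> (x, u) z \<noteq> \<infinity>"
    by (rule nn_integral_PInf_AE) (use fin in auto)
  have "(\<integral>\<^sup>+ w. ennreal (likelihood f (x, u) w * prior \<pi> a w)
        * indicator {w. fst w \<in> A \<and> tau (x, u) w \<in> B} w \<partial>(\<nu> \<Otimes>\<^sub>M lborel))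
    = (\<integral>\<^sup>+ w. ennreal (likelihood f (x, u) w * prior \<pi> a w)
        * indicator A (fst w) * indicator B (tau (x, u) w) \<partial>(\<nu> \<Otimes>\<^sub>M lborel))"
    by (rule nn_integral_cong) (simp split: split_indicator)
  also have "\<dots> = (\<integral>\<^sup>+ z. (\<integral>\<^sup>+ \<eta>. ennreal (likelihood f (x, u) (z, \<eta>) * prior \<pi> a (z, \<eta>))
        * indicator A z * indicator B (tau (x, u) (z, \<eta>)) \<partial>lborel) \<partial>\<nu>)"
    by (subst lborel.nn_integral_fst[symmetric]) (simp_all)
  also have "\<dots> = (\<integral>\<^sup>+ z. theta_kernel (a + 1 + n / 2) \<pi> (x, u) z * indicator A z
        * (\<integral>\<^sup>+ t. tau_kernel (a + n / 2) f t * indicator B t \<partial>lborel) \<partial>\<nu>)"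
  proof (rule nn_integral_cong_AE, use AE in eventually_elim)
    case (elim z)
    have "0 \<le> \<pi> z" using \<pi> by (simp add: prior_factor_def)
    from nn_integral_eta[where \<pi> = \<pi>, OF f this elim[unfolded n_def] B] show ?case
      by (cases "z \<in> A") (simp_all add: n_def)
  qed
  also have "\<dots> = (\<integral>\<^sup>+ z. theta_kernel (a + 1 + n / 2) \<pi> (x, u) z * indicator A z \<partial>\<nu>)
        * (\<integral>\<^sup>+ t. tau_kernel (a + n / 2) f t * indicator B t \<partial>lborel)"
    by (rule nn_integral_multc) simp
  finally show ?thesis .
qed

text \<open>The normalizing constant in Bayes' formula is the rectangle identity for
  \<open>A = UNIV\<close> and \<open>B = UNIV\<close>, so it factors in the same way as the
  numerator.\<close>

lemma emeasure_posterior_rectangle: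
  fixes x :: "real^'d" and u :: "real^'k"
  defines "n \<equiv> real CARD('d) + real CARD('k)"
  assumes \<nu>: "sigma_finite_measure \<nu>" "sets \<nu> = sets borel"
    and f: "radial_density TYPE('n::finite) f" and \<pi>: "prior_factor \<nu> \<pi>"
    and fin_tau: "(\<integral>\<^sup>+ t. tau_kernel (a + n / 2) f t \<partial>lborel) < \<infinity>"
    and fin: "(\<integral>\<^sup>+ z. theta_kernel (a + 1 + n / 2) \<pi> (x, u) z \<partial>\<nu>) < \<infinity>"
    and A: "A \<in> sets borel" and B: "B \<in> sets borel"
  shows "emeasure (posterior (\<nu> \<Otimes>\<^sub>M lborel) (likelihood f (x, u)) (prior \<pi> a))
        {w. fst w \<in> A \<and> tau (x, u) w \<in> B}
    = (\<integral>\<^sup>+ z. theta_kernel (a + 1 + n / 2) \<pi> (x, u) z * indicator A z \<partial>\<nu>)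
          / (\<integral>\<^sup>+ z. theta_kernel (a + 1 + n / 2) \<pi> (x, u) z \<partial>\<nu>)
        * ((\<integral>\<^sup>+ t. tau_kernel (a + n / 2) f t * indicator B t \<partial>lborel)
          / (\<integral>\<^sup>+ t. tau_kernel (a + n / 2) f t \<partial>lborel))"
    (is "_ = ?ThA / ?Th * (?TaB / ?Ta)")
proof -
  note \<nu>(2)[measurable_cong] A[measurable] B[measurable]
    likelihood_prior_measurable[OF \<nu>(2) f \<pi>, measurable] tau_measurable[measurable]
  have [measurable]: "tau (x, u) \<in> borel_measurable (\<nu> \<Otimes>\<^sub>M lborel)" by measurable
  have sp: "space (\<nu> \<Otimes>\<^sub>M lborel) = UNIV"
    using sets_eq_imp_space_eq[OF \<nu>(2)] by (simp add: space_pair_measure)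
  have [measurable]: "{w. fst w \<in> A \<and> tau (x, u) w \<in> B} \<in> sets (\<nu> \<Otimes>\<^sub>M lborel)"
  proof -
    have "{w \<in> space (\<nu> \<Otimes>\<^sub>M lborel). fst w \<in> A \<and> tau (x, u) w \<in> B} \<in> sets (\<nu> \<Otimes>\<^sub>M lborel)"
      by measurable
    then show ?thesis by (simp add: sp)
  qed
  let ?l = "\<lambda>w. ennreal (likelihood f (x, u) w * prior \<pi> a w)"
  note rect = nn_integral_rectangle[OF \<nu> f \<pi> fin[unfolded n_def], folded n_def]
  have Z: "(\<integral>\<^sup>+ w. ?l w \<partial>(\<nu> \<Otimes>\<^sub>M lborel)) = ?Th * ?Ta"
    using rect[of UNIV UNIV] by simp
  have "emeasure (posterior (\<nu> \<Otimes>\<^sub>M lborel) (likelihood f (x, u)) (prior \<pi> a))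
        {w. fst w \<in> A \<and> tau (x, u) w \<in> B}
    = (\<integral>\<^sup>+ w. ?l w / (?Th * ?Ta) * indicator {w. fst w \<in> A \<and> tau (x, u) w \<in> B} w
        \<partial>(\<nu> \<Otimes>\<^sub>M lborel))"
    unfolding posterior_def Z by (rule emeasure_density) measurable
  also have "\<dots> = (\<integral>\<^sup>+ w. ?l w * indicator {w. fst w \<in> A \<and> tau (x, u) w \<in> B} w
        \<partial>(\<nu> \<Otimes>\<^sub>M lborel)) / (?Th * ?Ta)"
    by (subst nn_integral_divide[symmetric], measurable) (simp add: ennreal_times_divide mult.commute)
  also have "\<dots> = ?ThA * ?TaB / (?Th * ?Ta)" by (simp only: rect[OF A B])
  \<comment> \<open>In \<open>ennreal\<close> the inverse of a product does not split when one
    factor is 0 and the other infinite; here both are finite.\<close>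
  also have "\<dots> = ?ThA / ?Th * (?TaB / ?Ta)"
    using fin fin_tau nn_integral_theta_kernel_neq_0[OF \<nu>(2) \<pi>, of "a + 1 + n / 2" x u]
      nn_integral_tau_kernel_neq_0[OF f, of "a + n / 2"]
    by (simp add: divide_ennreal_def ennreal_inverse_mult mult_ac less_top)
  finally show ?thesis .
qed

section \<open>From set probabilities to independence and proportional densities\<close>

lemma Int_stable_vimage_sets: "Int_stable {Z -` A \<inter> \<Omega> | A. A \<in> sets N}"
proof (rule Int_stableI, safe)
  fix A B assume "A \<in> sets N" "B \<in> sets N"
  then show "\<exists>C. (Z -` A \<inter> \<Omega>) \<inter> (Z -` B \<inter> \<Omega>) = Z -` C \<inter> \<Omega> \<and> C \<in> sets N"
    by (intro exI[of _ "A \<inter> B"]) auto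
qed

text \<open>Preimages of measurable sets form an intersection-stable family, so the product formula
  on them extends to the generated sigma-algebras.\<close>

lemma indep_var_hetI:
  assumes P: "prob_space P" and X: "X \<in> measurable P S" and Y: "Y \<in> measurable P T"
    and *: "\<And>A B. A \<in> sets S \<Longrightarrow> B \<in> sets T \<Longrightarrow>
      emeasure P ((X -` A \<inter> space P) \<inter> (Y -` B \<inter> space P))
        = emeasure P (X -` A \<inter> space P) * emeasure P (Y -` B \<inter> space P)"
  shows "indep_var_het P S X T Y"
proof -
  interpret prob_space P by fact
  have "indep_set {X -` A \<inter> space P | A. A \<in> sets S} {Y -` B \<inter> space P | B. B \<in> sets T}"
  proof (rule indep_setI)
    fix a b assume "a \<in> {X -` A \<inter> space P | A. A \<in> sets S}" "b \<in> {Y -` B \<inter> space P | B. B \<in> sets T}"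
    then show "prob (a \<inter> b) = prob a * prob b"
      using * by (auto simp: measure_def enn2real_mult[symmetric])
  qed (use X Y in \<open>auto intro: measurable_sets\<close>)
  then show ?thesis
    unfolding indep_var_het_def using X Y by (auto intro!: indep_set_sigma_sets Int_stable_vimage_sets)
qed

text \<open>The constant of proportionality is the reciprocal of the integral of \<open>h\<close>, a
  positive real because that integral is neither 0 nor infinite.\<close>

lemma distributed_proportionalI:
  assumes Y: "Y \<in> measurable P N" and h: "h \<in> borel_measurable N"
    and Z: "(\<integral>\<^sup>+ y. h y \<partial>N) \<noteq> 0" "(\<integral>\<^sup>+ y. h y \<partial>N) < \<infinity>"
    and *: "\<And>B. B \<in> sets N \<Longrightarrow>
      emeasure P (Y -` B \<inter> space P) = (\<integral>\<^sup>+ y. h y * indicator B y \<partial>N) / (\<integral>\<^sup>+ y. h y \<partial>N)"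
  shows "distributed_proportional P N Y h"
proof -
  obtain r where r: "(\<integral>\<^sup>+ y. h y \<partial>N) = ennreal r" "0 < r"
    using Z by (cases "\<integral>\<^sup>+ y. h y \<partial>N") (auto simp: less_le ennreal_eq_0_iff)
  have "distr P N Y = density N (\<lambda>y. ennreal (1 / r) * h y)"
  proof (rule measure_eqI)
    fix B assume "B \<in> sets (distr P N Y)"
    then have B[measurable]: "B \<in> sets N" by simp
    have "emeasure (density N (\<lambda>y. ennreal (1 / r) * h y)) B
        = ennreal (1 / r) * (\<integral>\<^sup>+ y. h y * indicator B y \<partial>N)"
      using h by (simp add: emeasure_density mult.assoc nn_integral_cmult)
    also have "\<dots> = emeasure (distr P N Y) B"
      using r by (simp add: emeasure_distr[OF Y B] *[OF B] divide_ennreal_def inverse_ennreal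
          divide_inverse mult.commute)
    finally show "emeasure (distr P N Y) B = emeasure (density N (\<lambda>y. ennreal (1 / r) * h y)) B" ..
  qed simp
  then have "distributed P N Y (\<lambda>y. ennreal (1 / r) * h y)"
    using Y h by (simp add: distributed_def)
  then show ?thesis
    unfolding distributed_proportional_def using r by (intro exI[of _ "1 / r"]) simp
qed

theorem theorem3p1:
  fixes f :: "real \<Rightarrow> real"
    and \<pi>\<^sub>1 :: "real^'d \<Rightarrow> real"
    and \<nu> :: "(real^'d) measure"
    and a :: real
    and x :: "real^'d" and u :: "real^'k"
  defines "n \<equiv> real CARD('d) + real CARD('k)"
  defines "post \<equiv> \<lambda>g \<pi>. posterior (\<nu> \<Otimes>\<^sub>M lborel) (likelihood g (x, u)) (prior \<pi> a)"
  assumes "sigma_finite_measure \<nu>" and "sets \<nu> = sets borel"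
    and "radial_density TYPE('d + 'k) f"
    and "prior_factor \<nu> \<pi>\<^sub>1"
    and "(\<integral>\<^sup>+ t. tau_kernel (a + n / 2) f t \<partial>lborel) < \<infinity>"
    and "(\<integral>\<^sup>+ z. theta_kernel (a + 1 + n / 2) \<pi>\<^sub>1 (x, u) z \<partial>\<nu>) < \<infinity>"
  shows "prob_space (post f \<pi>\<^sub>1) \<and>
    indep_var_het (post f \<pi>\<^sub>1) borel fst borel (tau (x, u)) \<and>
    distributed_proportional (post f \<pi>\<^sub>1) lborel (tau (x, u)) (tau_kernel (a + n / 2) f) \<and>
    distributed_proportional (post f \<pi>\<^sub>1) \<nu> fst (theta_kernel (a + 1 + n / 2) \<pi>\<^sub>1 (x, u)) \<and>
    (\<forall>g. radial_density TYPE('d + 'k) g \<longrightarrow>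
         (\<integral>\<^sup>+ t. tau_kernel (a + n / 2) g t \<partial>lborel) < \<infinity> \<longrightarrow>
         distr (post g \<pi>\<^sub>1) borel fst = distr (post f \<pi>\<^sub>1) borel fst) \<and>
    (\<forall>\<pi>. prior_factor \<nu> \<pi> \<longrightarrow>
         (\<integral>\<^sup>+ z. theta_kernel (a + 1 + n / 2) \<pi> (x, u) z \<partial>\<nu>) < \<infinity> \<longrightarrow>
         distr (post f \<pi>) borel (tau (x, u)) = distr (post f \<pi>\<^sub>1) borel (tau (x, u)))"
proof -
  note \<nu> = assms(3,4) and f = assms(5) and \<pi>\<^sub>1 = assms(6) and fin_f = assms(7) and fin_\<pi>\<^sub>1 = assms(8)
  note \<nu>(2)[measurable_cong] tau_measurable[measurable]
  have sets_post[measurable_cong]: "sets (post g \<pi>) = sets (\<nu> \<Otimes>\<^sub>M lborel)" for g \<pi>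
    by (simp add: post_def posterior_def)
  have space_post: "space (post g \<pi>) = UNIV" for g \<pi>
    using sets_eq_imp_space_eq[OF sets_post] sets_eq_imp_space_eq[OF \<nu>(2)]
    by (simp add: space_pair_measure)
  have fst_meas: "fst \<in> measurable (post g \<pi>) borel" for g \<pi> by measurable
  have tau_meas: "tau (x, u) \<in> measurable (post g \<pi>) borel" for g \<pi> by measurable
  let ?Th = "\<lambda>\<pi>. \<integral>\<^sup>+ z. theta_kernel (a + 1 + n / 2) \<pi> (x, u) z \<partial>\<nu>"
  let ?ThA = "\<lambda>\<pi> A. \<integral>\<^sup>+ z. theta_kernel (a + 1 + n / 2) \<pi> (x, u) z * indicator A z \<partial>\<nu>"
  let ?Ta = "\<lambda>g. \<integral>\<^sup>+ t. tau_kernel (a + n / 2) g t \<partial>lborel"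
  let ?TaB = "\<lambda>g B. \<integral>\<^sup>+ t. tau_kernel (a + n / 2) g t * indicator B t \<partial>lborel"
  note Th0 = nn_integral_theta_kernel_neq_0[OF \<nu>(2), of _ "a + 1 + n / 2" x u]
  note Ta0 = nn_integral_tau_kernel_neq_0[where 'n = "'d + 'k" and q = "a + n / 2"]
  \<comment> \<open>The generator and the prior factor are kept general because the last two claims
    compare posteriors that differ in one of them.\<close>
  have rect: "emeasure (post g \<pi>) {w. fst w \<in> A \<and> tau (x, u) w \<in> B}
      = ?ThA \<pi> A / ?Th \<pi> * (?TaB g B / ?Ta g)"
    if "radial_density TYPE('d + 'k) g" "prior_factor \<nu> \<pi>" "?Ta g < \<infinity>" "?Th \<pi> < \<infinity>"
      "A \<in> sets borel" "B \<in> sets borel" for g \<pi> A B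
    unfolding post_def n_def
    by (rule emeasure_posterior_rectangle[OF \<nu> that[unfolded n_def]])
  \<comment> \<open>With \<open>B = UNIV\<close> the \<tau>-ratio is 1, its integral being neither 0
    nor infinite. The marginal of \<theta> thus has a formula without \<open>g\<close>, and
    symmetrically the marginal of \<tau> has one without \<open>\<pi>\<close>.\<close>
  have theta: "emeasure (post g \<pi>) (fst -` A) = ?ThA \<pi> A / ?Th \<pi>"
    if "radial_density TYPE('d + 'k) g" "prior_factor \<nu> \<pi>" "?Ta g < \<infinity>" "?Th \<pi> < \<infinity>"
      "A \<in> sets borel" for g \<pi> A
    using rect[OF that, of UNIV] that Ta0[of g]
    by (simp add: vimage_def ennreal_divide_self less_top)
  have tau: "emeasure (post g \<pi>) (tau (x, u) -` B) = ?TaB g B / ?Ta g"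
    if "radial_density TYPE('d + 'k) g" "prior_factor \<nu> \<pi>" "?Ta g < \<infinity>" "?Th \<pi> < \<infinity>"
      "B \<in> sets borel" for g \<pi> B
    using rect[OF that(1-4) _ that(5), of UNIV] that Th0[of \<pi>]
    by (simp add: vimage_def ennreal_divide_self less_top)
  note asm = f \<pi>\<^sub>1 fin_f fin_\<pi>\<^sub>1
  have prob: "prob_space (post f \<pi>\<^sub>1)"
    using theta[OF asm, of UNIV] asm Th0[of \<pi>\<^sub>1]
    by (intro prob_spaceI) (simp add: space_post ennreal_divide_self less_top)
  moreover have "indep_var_het (post f \<pi>\<^sub>1) borel fst borel (tau (x, u))"
  proof (rule indep_var_hetI[OF prob fst_meas tau_meas])
    fix A :: "(real^'d) set" and B :: "real set" assume A: "A \<in> sets borel" and B: "B \<in> sets borel"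
    have "fst -` A \<inter> tau (x, u) -` B = {w. fst w \<in> A \<and> tau (x, u) w \<in> B}" by auto
    then show "emeasure (post f \<pi>\<^sub>1)
          ((fst -` A \<inter> space (post f \<pi>\<^sub>1)) \<inter> (tau (x, u) -` B \<inter> space (post f \<pi>\<^sub>1)))
        = emeasure (post f \<pi>\<^sub>1) (fst -` A \<inter> space (post f \<pi>\<^sub>1))
          * emeasure (post f \<pi>\<^sub>1) (tau (x, u) -` B \<inter> space (post f \<pi>\<^sub>1))"
      by (simp add: space_post theta[OF asm A] tau[OF asm B] rect[OF asm A B])
  qed
  moreover have "distributed_proportional (post f \<pi>\<^sub>1) lborel (tau (x, u)) (tau_kernel (a + n / 2) f)"
    using tau_meas tau_kernel_measurable[OF f] Ta0[OF f] fin_f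
    by (intro distributed_proportionalI) (auto simp: space_post tau[OF asm])
  moreover have "distributed_proportional (post f \<pi>\<^sub>1) \<nu> fst (theta_kernel (a + 1 + n / 2) \<pi>\<^sub>1 (x, u))"
    using theta_kernel_measurable[OF \<nu>(2) \<pi>\<^sub>1] Th0[OF \<pi>\<^sub>1] fin_\<pi>\<^sub>1
    by (intro distributed_proportionalI) (auto simp: space_post theta[OF asm] \<nu>(2))
  moreover have "distr (post g \<pi>\<^sub>1) borel fst = distr (post f \<pi>\<^sub>1) borel fst"
    if "radial_density TYPE('d + 'k) g" "?Ta g < \<infinity>" for g
    by (rule measure_eqI)
       (auto simp: emeasure_distr[OF fst_meas] space_post theta[OF asm] theta[OF that(1) \<pi>\<^sub>1 that(2) fin_\<pi>\<^sub>1])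
  moreover have "distr (post f \<pi>) borel (tau (x, u)) = distr (post f \<pi>\<^sub>1) borel (tau (x, u))"
    if "prior_factor \<nu> \<pi>" "?Th \<pi> < \<infinity>" for \<pi>
    by (rule measure_eqI)
       (auto simp: emeasure_distr[OF tau_meas] space_post tau[OF asm] tau[OF f that(1) fin_f that(2)])
  ultimately show ?thesis by blast
qed

end
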